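(* For every $n\ge 2$ and $\epsilon>0$, the set $\{P_\tau:\tau\in S_n\}\subset\mathbb{U}_N$ of qubit-permutation operators can be $\epsilon$-tested with query complexity $O(n\log n/\epsilon^2)$, with implied constant independent of $n$ and $\epsilon$.
   Context: $N=2^n$, $\mathbb{U}_N$ the $N\times N$ unitaries, $S_n$ the symmetric group on $\{1,\dots,n\}$, and for $\tau\in S_n$, $P_\tau|i_1,\dots,i_n\rangle=|i_{\tau(1)},\dots,i_{\tau(n)}\rangle$ for $i_j\in\{0,1\}$. $\|A\|=\sqrt{\mathrm{tr}(A^\dagger A)}$; $D(A,B)=\min_{\theta\in[0,2\pi)}\frac{1}{\sqrt{2N}}\|e^{i\theta}A-B\|$. For $\mathcal{S}\subseteq\mathbb{U}_N$, $U$ has property $\mathcal{S}$ if $U=e^{i\theta}V$ for some $V\in\mathcal{S}$, real $\theta$; $U$ is $\epsilon$-far from $\mathcal{S}$ if $D(U,V)\ge\epsilon$ for all $V\in\mathcal{S}$. Testing model: the unknown $U\in\mathbb{U}_N$ is a black box; the algorithm may prepare arbitrary states on the system plus an ancilla, apply $U\otimes I$ (one query each), interleaved with arbitrary fixed quantum operations, and measure. It $\epsilon$-tests $\mathcal{S}$ if for every $U\in\mathbb{U}_N$ it accepts with probability $\ge2/3$ when $U$ has property $\mathcal{S}$ and with probability $\le1/3$ when $U$ is $\epsilon$-far from $\mathcal{S}$. *)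

theory Defs
  imports "Jordan_Normal_Form.Matrix" "HOL-Combinatorics.Permutations" Complex_Main
begin

definition adj :: "complex mat \<Rightarrow> complex mat" where
  "adj A = mat (dim_col A) (dim_row A) (\<lambda>(i,j). cnj (A $$ (j,i)))"

definition unitaries :: "nat \<Rightarrow> complex mat set" where
  "unitaries N = {U. U \<in> carrier_mat N N \<and> U * adj U = 1\<^sub>m N \<and> adj U * U = 1\<^sub>m N}"

definition mtrace :: "complex mat \<Rightarrow> complex" where
  "mtrace A = (\<Sum>i<dim_row A. A $$ (i,i))"

definition frob :: "complex mat \<Rightarrow> real" where
  "frob A = sqrt (Re (mtrace (adj A * A)))"

text \<open>D(A,B) = min over theta in [0,2pi) of ||e^{i theta} A - B|| / sqrt(2N).
  The minimum is attained (continuity + periodicity), so it equals the infimum.\<close>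
definition Dist :: "nat \<Rightarrow> complex mat \<Rightarrow> complex mat \<Rightarrow> real" where
  "Dist N A B = (INF \<theta>\<in>{0..<2*pi}. frob (exp (\<i> * complex_of_real \<theta>) \<cdot>\<^sub>m A - B) / sqrt (2 * real N))"

definition has_property :: "complex mat set \<Rightarrow> complex mat \<Rightarrow> bool" where
  "has_property S U \<longleftrightarrow> (\<exists>V\<in>S. \<exists>\<theta>::real. U = exp (\<i> * complex_of_real \<theta>) \<cdot>\<^sub>m V)"

definition eps_far :: "nat \<Rightarrow> real \<Rightarrow> complex mat set \<Rightarrow> complex mat \<Rightarrow> bool" where
  "eps_far N \<epsilon> S U \<longleftrightarrow> (\<forall>V\<in>S. Dist N U V \<ge> \<epsilon>)"

text \<open>Bits of a basis index x in {0..<2^n}: bit k (k = 1..n) is i_k, with i_1 the most significant.\<close>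
definition qbit :: "nat \<Rightarrow> nat \<Rightarrow> nat \<Rightarrow> nat" where
  "qbit n x k = (x div 2 ^ (n - k)) mod 2"

text \<open>P_tau |i_1..i_n> = |i_{tau 1} .. i_{tau n}>: entry (r,c) is 1 iff bit k of r equals bit tau(k) of c.\<close>
definition perm_op :: "nat \<Rightarrow> (nat \<Rightarrow> nat) \<Rightarrow> complex mat" where
  "perm_op n \<tau> = mat (2^n) (2^n)
     (\<lambda>(r,c). if (\<forall>k\<in>{1..n}. qbit n r k = qbit n c (\<tau> k)) then 1 else 0)"

definition qubit_perms :: "nat \<Rightarrow> complex mat set" where
  "qubit_perms n = {perm_op n \<tau> | \<tau>. \<tau> permutes {1..n}}"

definition kron :: "complex mat \<Rightarrow> complex mat \<Rightarrow> complex mat" where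
  "kron A B = mat (dim_row A * dim_row B) (dim_col A * dim_col B)
     (\<lambda>(i,j). A $$ (i div dim_row B, j div dim_col B) * B $$ (i mod dim_row B, j mod dim_col B))"

text \<open>A general query algorithm (purified form): ancilla dimension d, initial unit state psi on
  system (dimension N) tensor ancilla, list Vs of fixed unitaries on the joint system; each element
  of Vs is preceded by one query U tensor I; final two-outcome projective measurement with
  accept projector E.  Arbitrary quantum operations / intermediate measurements / mixed states
  reduce to this form by Stinespring dilation, deferred measurement and purification
  (with a large enough ancilla), and POVMs reduce to projective measurements (Naimark).\<close>
record alg =
  anc_dim :: nat
  init_state :: "complex vec"
  ops :: "complex mat list"
  accept_proj :: "complex mat"

definition num_queries :: "alg \<Rightarrow> nat" where
  "num_queries A = length (ops A)"

definition valid_alg :: "nat \<Rightarrow> alg \<Rightarrow> bool" where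
  "valid_alg N A \<longleftrightarrow>
     anc_dim A \<ge> 1 \<and>
     init_state A \<in> carrier_vec (N * anc_dim A) \<and>
     init_state A \<bullet>c init_state A = 1 \<and>
     (\<forall>V\<in>set (ops A). V \<in> unitaries (N * anc_dim A)) \<and>
     accept_proj A \<in> carrier_mat (N * anc_dim A) (N * anc_dim A) \<and>
     adj (accept_proj A) = accept_proj A \<and>
     accept_proj A * accept_proj A = accept_proj A"

definition final_state :: "alg \<Rightarrow> complex mat \<Rightarrow> complex vec" where
  "final_state A U =
     foldl (\<lambda>\<phi> V. V *\<^sub>v (kron U (1\<^sub>m (anc_dim A)) *\<^sub>v \<phi>)) (init_state A) (ops A)"

definition accept_prob :: "alg \<Rightarrow> complex mat \<Rightarrow> real" where
  "accept_prob A U = (let \<phi> = final_state A U in Re ((accept_proj A *\<^sub>v \<phi>) \<bullet>c \<phi>))"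

definition eps_tests :: "nat \<Rightarrow> real \<Rightarrow> complex mat set \<Rightarrow> alg \<Rightarrow> bool" where
  "eps_tests N \<epsilon> S A \<longleftrightarrow> valid_alg N A \<and>
     (\<forall>U\<in>unitaries N.
        (has_property S U \<longrightarrow> accept_prob A U \<ge> 2/3) \<and>
        (eps_far N \<epsilon> S U \<longrightarrow> accept_prob A U \<le> 1/3))"

end

theory Submission
  imports Defs "Jordan_Normal_Form.Determinant"
begin

text \<open>
  Query \<open>U\<close> on the \<open>n\<close> basis states with exactly one qubit set, and \<open>k\<close> times, with
  \<open>k \<ge> 1 / \<epsilon>\<^sup>2\<close>, on half of a maximally entangled state. If \<open>U = e\<^sup>i\<^sup>\<theta> P\<^sub>\<tau>\<close>, the \<open>n\<close> basis
  outputs \<open>y\<close> determine \<open>\<tau>\<close>. The test measures \<open>y\<close> and accepts iff the \<open>k\<close> remaining registers all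
  project onto the Choi state of the operator guessed from \<open>y\<close>; the accept projector is therefore
  block diagonal in \<open>y\<close> with rank-one blocks. It accepts with certainty when \<open>U\<close> has the property.
  Since \<open>D(U, V)\<^sup>2 = 1 - |tr(V\<^sup>\<dagger> U)| / N\<close>, a far \<open>U\<close> passes with probability at most
  \<open>(1 - \<epsilon>\<^sup>2)\<^bsup>2k\<^esup> \<le> 1 / 3\<close> whatever the guess. Nothing but the identification by basis states is
  specific to qubit permutations. The \<open>n + k\<close> queries stay within the claimed bound when \<open>\<epsilon> \<le> 1\<close>;
  no unitary is \<open>\<epsilon>\<close>-far when \<open>\<epsilon> > 1\<close>.
\<close>

section \<open>Sums, entries and unitary matrices\<close>

lemma sum_lessThan_mult:
  fixes f :: "nat \<Rightarrow> 'a::comm_monoid_add"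
  shows "(\<Sum>i<m * n. f i) = (\<Sum>a<m. \<Sum>b<n. f (a * n + b))"
proof -
  have "sum f {a * n..<a * n + n} = (\<Sum>b<n. f (a * n + b))" for a
    using sum.shift_bounds_nat_ivl[of f 0 "a * n" n]
    by (simp add: add.commute lessThan_atLeast0)
  then show ?thesis
    using sum.nat_group[of f n m] by simp
qed

lemma mult_add_less_mult:
  fixes a b m n :: nat
  assumes "a < m" "b < n"
  shows "a * n + b < m * n"
proof -
  have "a * n + b < Suc a * n" using assms(2) by simp
  also have "\<dots> \<le> m * n" using assms(1) by (intro mult_le_mono1) simp
  finally show ?thesis .
qed

lemma bij_betw_lessThan_endoI:
  fixes f :: "nat \<Rightarrow> nat"
  assumes "inj_on f {..<m}" "\<And>i. i < m \<Longrightarrow> f i < m"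
  shows "bij_betw f {..<m} {..<m}"
proof -
  have "f ` {..<m} \<subseteq> {..<m}" using assms(2) by auto
  then show ?thesis using assms(1) by (simp add: bij_betw_def endo_inj_surj)
qed

lemma index_mult_mat_vec_sum:
  assumes "A \<in> carrier_mat m n" "v \<in> carrier_vec n" "i < m"
  shows "(A *\<^sub>v v) $ i = (\<Sum>j<n. A $$ (i, j) * v $ j)"
  using assms by (simp add: scalar_prod_def lessThan_atLeast0)

lemma index_mult_mat_sum:
  assumes "A \<in> carrier_mat l m" "B \<in> carrier_mat m n" "i < l" "j < n"
  shows "(A * B) $$ (i, j) = (\<Sum>k<m. A $$ (i, k) * B $$ (k, j))"
  using assms by (simp add: scalar_prod_def lessThan_atLeast0)

definition cdot :: "nat \<Rightarrow> (nat \<Rightarrow> complex) \<Rightarrow> (nat \<Rightarrow> complex) \<Rightarrow> complex" where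
  "cdot n f g = (\<Sum>i<n. cnj (f i) * g i)"

lemma cdot_self: "cdot n f f = of_real (\<Sum>i<n. (cmod (f i))\<^sup>2)"
  unfolding cdot_def of_real_sum complex_norm_square by (simp only: mult.commute)

lemma cdot_of_bool_eq: "cdot n (\<lambda>i. of_bool (i = a)) g = (if a < n then g a else 0)"
proof -
  have "cdot n (\<lambda>i. of_bool (i = a)) g = (\<Sum>i<n. if i = a then g a else 0)"
    unfolding cdot_def by (intro sum.cong) auto
  then show ?thesis by simp
qed

lemma vec_cscalar_prod_vec: "vec n f \<bullet>c vec n g = cdot n g f"
  by (simp add: scalar_prod_def cdot_def lessThan_atLeast0 mult.commute)

lemma adj_carrier [simp]: "A \<in> carrier_mat m n \<Longrightarrow> adj A \<in> carrier_mat n m"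
  by (simp add: adj_def)

lemma index_adj_mult:
  assumes A: "A \<in> carrier_mat m n" and B: "B \<in> carrier_mat m p" and less: "x < n" "y < p"
  shows "(adj A * B) $$ (x, y) = cdot m (\<lambda>i. A $$ (i, x)) (\<lambda>i. B $$ (i, y))"
  unfolding cdot_def index_mult_mat_sum[OF adj_carrier[OF A] B less]
  using A less by (intro sum.cong) (auto simp: adj_def)

lemma unitaries_carrier: "U \<in> unitaries N \<Longrightarrow> U \<in> carrier_mat N N"
  by (simp add: unitaries_def)

lemma unitariesI:
  assumes U: "U \<in> carrier_mat N N"
    and columns: "\<And>x y. x < N \<Longrightarrow> y < N \<Longrightarrow>
      cdot N (\<lambda>i. U $$ (i, x)) (\<lambda>i. U $$ (i, y)) = of_bool (x = y)"
  shows "U \<in> unitaries N"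
proof -
  have "adj U * U = 1\<^sub>m N"
    by (rule eq_matI) (use U in \<open>auto simp: columns index_adj_mult[OF U U]
      carrier_matD(1)[OF adj_carrier[OF U]] simp del: index_mult_mat(1)\<close>)
  then show ?thesis
    using U mat_mult_left_right_inverse[OF adj_carrier[OF U] U] by (simp add: unitaries_def)
qed

lemma unitary_columns_orthonormal:
  assumes "U \<in> unitaries N" "x < N" "y < N"
  shows "cdot N (\<lambda>i. U $$ (i, x)) (\<lambda>i. U $$ (i, y)) = of_bool (x = y)"
  using index_adj_mult[OF unitaries_carrier unitaries_carrier, OF assms(1,1,2,3)] assms
  by (auto simp: unitaries_def)

definition perm_mat :: "nat \<Rightarrow> (nat \<Rightarrow> nat) \<Rightarrow> complex mat" where
  "perm_mat m f = mat m m (\<lambda>(r, c). of_bool (r = f c))"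

lemma perm_mat_carrier [simp]: "perm_mat m f \<in> carrier_mat m m"
  by (simp add: perm_mat_def)

lemma perm_mat_unitary:
  assumes "bij_betw f {..<m} {..<m}"
  shows "perm_mat m f \<in> unitaries m"
proof (rule unitariesI)
  fix x y assume less: "x < m" "y < m"
  then have "f x < m" "f x = f y \<longleftrightarrow> x = y"
    using assms by (auto simp: bij_betw_def inj_on_def)
  moreover have "cdot m (\<lambda>i. perm_mat m f $$ (i, x)) (\<lambda>i. perm_mat m f $$ (i, y)) =
      cdot m (\<lambda>i. of_bool (i = f x)) (\<lambda>i. of_bool (i = f y))"
    unfolding cdot_def using less by (intro sum.cong) (auto simp: perm_mat_def)
  ultimately show
    "cdot m (\<lambda>i. perm_mat m f $$ (i, x)) (\<lambda>i. perm_mat m f $$ (i, y)) = of_bool (x = y)"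
    by (simp only: cdot_of_bool_eq if_True)
qed simp

lemma perm_mat_mult_vec:
  assumes "bij_betw f {..<m} {..<m}"
  shows "perm_mat m f *\<^sub>v vec m (\<lambda>i. g (f i)) = vec m g"
proof (rule eq_vecI)
  fix r assume "r < dim_vec (vec m g)"
  then have r_less: "r < m" by simp
  have "(perm_mat m f *\<^sub>v vec m (\<lambda>i. g (f i))) $ r = (\<Sum>i<m. if f i = r then g (f i) else 0)"
    unfolding index_mult_mat_vec_sum[OF perm_mat_carrier vec_carrier r_less]
    using r_less by (intro sum.cong) (auto simp: perm_mat_def)
  also have "\<dots> = (\<Sum>c<m. if c = r then g c else 0)"
    by (rule sum.reindex_bij_betw[OF assms])
  finally show "(perm_mat m f *\<^sub>v vec m (\<lambda>i. g (f i))) $ r = vec m g $ r"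
    using r_less by simp
qed (simp add: perm_mat_def)

section \<open>Hilbert--Schmidt inner product and distance\<close>

definition hs_inner :: "complex mat \<Rightarrow> complex mat \<Rightarrow> complex" where
  "hs_inner A B = mtrace (adj A * B)"

lemma hs_inner_sum:
  assumes A: "A \<in> carrier_mat m n" and B: "B \<in> carrier_mat m n"
  shows "hs_inner A B = (\<Sum>i<m. \<Sum>j<n. cnj (A $$ (i, j)) * B $$ (i, j))"
proof -
  have "hs_inner A B = (\<Sum>j<n. (adj A * B) $$ (j, j))"
    using A by (simp add: hs_inner_def mtrace_def adj_def)
  also have "\<dots> = (\<Sum>j<n. \<Sum>i<m. cnj (A $$ (i, j)) * B $$ (i, j))"
    by (intro sum.cong refl) (simp add: index_adj_mult[OF A B] cdot_def del: index_mult_mat)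
  finally show ?thesis by (simp only: sum.swap[of _ "{..<n}"])
qed

lemma hs_inner_self_unitary: "U \<in> unitaries N \<Longrightarrow> hs_inner U U = of_nat N"
  by (simp add: hs_inner_def unitaries_def mtrace_def)

lemma hs_inner_smult_right:
  assumes "A \<in> carrier_mat m n" "B \<in> carrier_mat m n"
  shows "hs_inner A (c \<cdot>\<^sub>m B) = c * hs_inner A B"
  using assms by (simp add: hs_inner_sum[of _ m n] sum_distrib_left mult.left_commute)

lemma Re_hs_inner_self:
  assumes "A \<in> carrier_mat m n"
  shows "Re (hs_inner A A) = (\<Sum>i<m. \<Sum>j<n. (cmod (A $$ (i, j)))\<^sup>2)"
  unfolding hs_inner_sum[OF assms assms] cmod_power2 Re_sum by (simp add: power2_eq_square)

lemma frob_nonneg: "A \<in> carrier_mat m n \<Longrightarrow> frob A \<ge> 0"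
  by (simp add: frob_def Re_hs_inner_self sum_nonneg flip: hs_inner_def)

lemma frob_power2: "A \<in> carrier_mat m n \<Longrightarrow> (frob A)\<^sup>2 = (\<Sum>i<m. \<Sum>j<n. (cmod (A $$ (i, j)))\<^sup>2)"
  by (simp add: frob_def Re_hs_inner_self sum_nonneg flip: hs_inner_def)

lemma frob_unitary: "U \<in> unitaries N \<Longrightarrow> (frob U)\<^sup>2 = N"
  by (simp add: frob_def hs_inner_self_unitary flip: hs_inner_def)

lemma frob_diff_power2:
  assumes A: "A \<in> carrier_mat m n" and B: "B \<in> carrier_mat m n" and c: "cmod c = 1"
  shows "(frob (c \<cdot>\<^sub>m A - B))\<^sup>2 = (frob A)\<^sup>2 + (frob B)\<^sup>2 - 2 * Re (c * hs_inner B A)"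
proof -
  have "(cmod (c * a - b))\<^sup>2 = (cmod (c * a))\<^sup>2 + (cmod b)\<^sup>2 - 2 * Re (cnj b * (c * a))" for a b
    unfolding cmod_power2 by (simp add: power2_eq_square algebra_simps)
  then have "(cmod (c * a - b))\<^sup>2 = (cmod a)\<^sup>2 + (cmod b)\<^sup>2 - 2 * Re (c * (cnj b * a))" for a b
    by (simp only: norm_mult c mult_1 mult.left_commute)
  then show ?thesis
    unfolding frob_power2[OF A] frob_power2[OF B] frob_power2[OF minus_carrier_mat[OF B]]
      hs_inner_sum[OF B A] sum_distrib_left Re_sum
    using A B by (simp add: sum.distrib sum_subtractf)
qed

lemma ex_phase_mult_eq_cmod:
  "\<exists>\<theta>\<in>{0..<2 * pi}. exp (\<i> * complex_of_real \<theta>) * z = cmod z"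
proof (cases "z = 0")
  case True
  then show ?thesis by (intro bexI[of _ 0]) auto
next
  case False
  let ?c = "cnj z / cmod z"
  have "cmod ?c = 1" using False by (simp add: norm_divide)
  then have "(Re ?c)\<^sup>2 + (Im ?c)\<^sup>2 = 1" by (metis cmod_power2 power_one)
  then obtain \<theta> where \<theta>: "0 \<le> \<theta>" "\<theta> < 2 * pi" "Re ?c = cos \<theta>" "Im ?c = sin \<theta>"
    by (rule sincos_total_2pi)
  then have "exp (\<i> * complex_of_real \<theta>) = ?c"
    by (simp add: complex_eq_iff cis_conv_exp[symmetric])
  then have "exp (\<i> * complex_of_real \<theta>) * z = cmod z"
    using False by (simp add: complex_norm_square[symmetric] mult.commute power2_eq_square)
  then show ?thesis using \<theta> by auto
qed

lemma Dist_unitaries: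
  assumes N: "N > 0" and U: "U \<in> unitaries N" and V: "V \<in> unitaries N"
  shows "Dist N U V = sqrt (1 - cmod (hs_inner V U) / N)"
proof -
  let ?e = "\<lambda>\<theta>. exp (\<i> * complex_of_real \<theta>)" and ?t = "hs_inner V U"
  have scaled_frob:
    "frob (?e \<theta> \<cdot>\<^sub>m U - V) / sqrt (2 * real N) = sqrt (1 - Re (?e \<theta> * ?t) / N)" for \<theta>
  proof -
    have "(frob (?e \<theta> \<cdot>\<^sub>m U - V))\<^sup>2 = 2 * real N - 2 * Re (?e \<theta> * ?t)"
      using frob_diff_power2[OF unitaries_carrier[OF U] unitaries_carrier[OF V], of "?e \<theta>"]
      by (simp add: frob_unitary[OF U] frob_unitary[OF V])
    then have "(frob (?e \<theta> \<cdot>\<^sub>m U - V))\<^sup>2 / (2 * real N) = 1 - Re (?e \<theta> * ?t) / N"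
      using N by (simp add: field_simps)
    moreover have "frob (?e \<theta> \<cdot>\<^sub>m U - V) \<ge> 0"
      using unitaries_carrier[OF V] by (intro frob_nonneg minus_carrier_mat)
    ultimately show ?thesis
      by (metis abs_of_nonneg real_sqrt_abs real_sqrt_divide)
  qed
  show ?thesis
    unfolding Dist_def scaled_frob
  proof (rule cInf_eq_minimum)
    show "sqrt (1 - cmod ?t / N) \<in> (\<lambda>\<theta>. sqrt (1 - Re (?e \<theta> * ?t) / N)) ` {0..<2 * pi}"
      using ex_phase_mult_eq_cmod[of ?t]
      by (metis (no_types, lifting) Re_complex_of_real image_eqI)
  next
    fix d assume "d \<in> (\<lambda>\<theta>. sqrt (1 - Re (?e \<theta> * ?t) / N)) ` {0..<2 * pi}"
    then obtain \<theta> where d_eq: "d = sqrt (1 - Re (?e \<theta> * ?t) / N)" by auto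
    have "Re (?e \<theta> * ?t) \<le> cmod ?t"
      using complex_Re_le_cmod[of "?e \<theta> * ?t"] by (simp add: norm_mult)
    then show "sqrt (1 - cmod ?t / N) \<le> d"
      unfolding d_eq by (intro real_sqrt_le_mono diff_left_mono divide_right_mono) auto
  qed
qed

lemma eps_far_hs_inner_le:
  assumes "N > 0" "\<epsilon> > 0" "S \<subseteq> unitaries N" "U \<in> unitaries N" "eps_far N \<epsilon> S U" "V \<in> S"
  shows "cmod (hs_inner V U) / N \<le> 1 - \<epsilon>\<^sup>2"
proof -
  have "\<epsilon> \<le> sqrt (1 - cmod (hs_inner V U) / N)"
    using assms Dist_unitaries[of N U V] unfolding eps_far_def by (metis subsetD)
  then have "\<epsilon>\<^sup>2 \<le> 1 - cmod (hs_inner V U) / N"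
    using assms(2) by (intro sqrt_ge_absD) simp
  then show ?thesis by simp
qed

lemma eps_far_imp_le_one:
  assumes "N > 0" "\<epsilon> > 0" "S \<subseteq> unitaries N" "S \<noteq> {}" "U \<in> unitaries N" "eps_far N \<epsilon> S U"
  shows "\<epsilon> \<le> 1"
proof -
  obtain V where "V \<in> S" using assms(4) by blast
  then have "cmod (hs_inner V U) / N \<le> 1 - \<epsilon>\<^sup>2"
    using eps_far_hs_inner_le[OF assms(1-3,5,6)] by blast
  moreover have "0 \<le> cmod (hs_inner V U) / N" by simp
  ultimately have "\<epsilon>\<^sup>2 \<le> 1" by linarith
  then show ?thesis using assms(2) by (simp add: abs_square_le_1)
qed

section \<open>Pure tensors\<close>

text \<open>Base-\<open>D\<close> digits of the index select the registers, the head of the list belonging to the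
  least significant digit.\<close>

fun tensor :: "nat \<Rightarrow> (nat \<Rightarrow> complex) list \<Rightarrow> nat \<Rightarrow> complex" where
  "tensor D [] i = 1"
| "tensor D (h # hs) i = h (i mod D) * tensor D hs (i div D)"

lemma tensor_append:
  "tensor D (hs @ gs) i =
    tensor D hs (i mod D ^ length hs) * tensor D gs (i div D ^ length hs)"
proof (induction hs arbitrary: i)
  case (Cons h hs)
  have "i mod (D * D ^ length hs) div D = i div D mod D ^ length hs"
    by (cases "D = 0") (auto simp: mod_mult2_eq)
  moreover have "i mod (D * D ^ length hs) mod D = i mod D"
    by (simp add: mod_mod_cancel)
  ultimately show ?case
    using Cons by (simp add: div_mult2_eq mult.assoc)
qed simp

lemma tensor_neq_0_imp_nth_neq_0:
  "tensor D hs i \<noteq> 0 \<Longrightarrow> j < length hs \<Longrightarrow> (hs ! j) (i div D ^ j mod D) \<noteq> 0"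
proof (induction hs arbitrary: i j)
  case (Cons h hs)
  then show ?case by (cases j) (auto simp: div_mult2_eq)
qed simp

lemma cdot_tensor:
  assumes "length gs = length hs"
  shows "cdot (D ^ length hs) (tensor D gs) (tensor D hs) = (\<Prod>(g, h)\<leftarrow>zip gs hs. cdot D g h)"
  using assms
proof (induction gs hs rule: list_induct2)
  case (Cons g gs h hs)
  have "cdot (D ^ length (h # hs)) (tensor D (g # gs)) (tensor D (h # hs)) =
    (\<Sum>b<D ^ length hs. \<Sum>w<D. (cnj (g w) * h w) * (cnj (tensor D gs b) * tensor D hs b))"
    unfolding cdot_def length_Cons power_Suc2 sum_lessThan_mult
    by (intro sum.cong refl) (simp add: mult_ac)
  also have "\<dots> = cdot D g h * cdot (D ^ length hs) (tensor D gs) (tensor D hs)"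
    by (simp add: cdot_def sum_product sum.swap[of _ "{..<D}"])
  finally show ?case
    using Cons.IH by (simp del: tensor.simps)
qed (simp add: cdot_def)

lemma cdot_tensor_unit:
  assumes "\<And>h. h \<in> set hs \<Longrightarrow> cdot D h h = 1"
  shows "cdot (D ^ length hs) (tensor D hs) (tensor D hs) = 1"
proof -
  have "(\<Prod>(g, h)\<leftarrow>zip hs hs. cdot D g h) = 1"
    using assms by (induction hs) auto
  then show ?thesis by (simp add: cdot_tensor)
qed

lemma cdot_tensor_replicate:
  "cdot (D ^ k) (tensor D (replicate k g)) (tensor D (replicate k h)) = cdot D g h ^ k"
  using cdot_tensor[of "replicate k g" "replicate k h" D] by (simp add: prod_list_replicate)

section \<open>Queries on registers\<close>

definition apply_sys :: "nat \<Rightarrow> complex mat \<Rightarrow> (nat \<Rightarrow> complex) \<Rightarrow> nat \<Rightarrow> complex" where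
  "apply_sys d U f i = (\<Sum>a<dim_col U. U $$ (i div d, a) * f (a * d + i mod d))"

lemma kron_one_mult_vec:
  "kron U (1\<^sub>m d) *\<^sub>v vec (dim_col U * d) f = vec (dim_row U * d) (apply_sys d U f)"
proof (rule eq_vecI)
  fix i assume "i < dim_vec (vec (dim_row U * d) (apply_sys d U f))"
  then have i_less: "i < dim_row U * d" by simp
  then have d_pos: "d > 0" by (cases d) auto
  have kron_carrier: "kron U (1\<^sub>m d) \<in> carrier_mat (dim_row U * d) (dim_col U * d)"
    by (simp add: kron_def)
  have "(kron U (1\<^sub>m d) *\<^sub>v vec (dim_col U * d) f) $ i =
    (\<Sum>a<dim_col U. \<Sum>b<d. kron U (1\<^sub>m d) $$ (i, a * d + b) * vec (dim_col U * d) f $ (a * d + b))"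
    by (simp only: index_mult_mat_vec_sum[OF kron_carrier vec_carrier i_less] sum_lessThan_mult)
  also have "\<dots> = (\<Sum>a<dim_col U. \<Sum>b<d.
      if b = i mod d then U $$ (i div d, a) * f (a * d + i mod d) else 0)"
    using i_less d_pos by (intro sum.cong refl) (auto simp: kron_def mult_add_less_mult)
  also have "\<dots> = apply_sys d U f i"
    unfolding apply_sys_def using d_pos by simp
  finally show "(kron U (1\<^sub>m d) *\<^sub>v vec (dim_col U * d) f) $ i =
      vec (dim_row U * d) (apply_sys d U f) $ i"
    using i_less by simp
qed (simp add: kron_def)

lemma cdot_apply_sys:
  assumes U: "U \<in> unitaries N"
  shows "cdot (N * d) (apply_sys d U f) (apply_sys d U g) = cdot (N * d) f g"
proof -
  have [simp]: "dim_col U = N" using unitaries_carrier[OF U] by simp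
  have "(\<Sum>s<N. cnj (\<Sum>a<N. U $$ (s, a) * f (a * d + r)) * (\<Sum>b<N. U $$ (s, b) * g (b * d + r))) =
      (\<Sum>a<N. cnj (f (a * d + r)) * g (a * d + r))" for r
  proof -
    have "(\<Sum>s<N. cnj (\<Sum>a<N. U $$ (s, a) * f (a * d + r)) * (\<Sum>b<N. U $$ (s, b) * g (b * d + r))) =
        (\<Sum>s<N. \<Sum>a<N. \<Sum>b<N.
          cnj (U $$ (s, a)) * U $$ (s, b) * (cnj (f (a * d + r)) * g (b * d + r)))"
      unfolding cnj_sum sum_product by (simp add: mult_ac)
    also have "\<dots> = (\<Sum>a<N. \<Sum>b<N. \<Sum>s<N.
          cnj (U $$ (s, a)) * U $$ (s, b) * (cnj (f (a * d + r)) * g (b * d + r)))"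
      by (subst sum.swap) (intro sum.cong refl sum.swap)
    also have "\<dots> = (\<Sum>a<N. \<Sum>b<N. of_bool (a = b) * (cnj (f (a * d + r)) * g (b * d + r)))"
      unfolding sum_distrib_right[symmetric]
      using unitary_columns_orthonormal[OF U] by (simp add: cdot_def)
    finally show ?thesis by simp
  qed
  then have "(\<Sum>r<d. \<Sum>s<N. cnj (apply_sys d U f (s * d + r)) * apply_sys d U g (s * d + r)) =
      (\<Sum>r<d. \<Sum>s<N. cnj (f (s * d + r)) * g (s * d + r))"
    by (simp add: apply_sys_def)
  then show ?thesis
    unfolding cdot_def sum_lessThan_mult by (simp only: sum.swap[of _ "{..<d}"])
qed

lemma apply_sys_tensor_snoc:
  fixes M :: nat
  assumes i_less: "i < D ^ Suc (length hs)" and D: "D = dim_col U * M"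
  shows "apply_sys (M * D ^ length hs) U (tensor D (hs @ [h])) i =
    tensor D (hs @ [apply_sys M U h]) i"
proof -
  let ?K = "D ^ length hs"
  let ?q = "i div ?K"
  have q_less: "?q < D" using i_less by (simp add: less_mult_imp_div_less)
  have D_pos: "D > 0" using i_less by (cases D) auto
  then have M_pos: "M > 0" unfolding D by simp
  have "tensor D (hs @ [h]) (a * (M * ?K) + i mod (M * ?K)) =
      tensor D hs (i mod ?K) * h (a * M + ?q mod M)" if a_less: "a < dim_col U" for a
  proof -
    have "a * (M * ?K) + i mod (M * ?K) = (a * M + ?q mod M) * ?K + i mod ?K"
      using mod_mult2_eq[of i ?K M] by (simp add: algebra_simps)
    moreover have "a * M + ?q mod M < D"
      unfolding D using a_less M_pos by (intro mult_add_less_mult) auto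
    ultimately show ?thesis using D_pos by (simp add: tensor_append)
  qed
  moreover have "i div (M * ?K) = ?q div M"
    by (metis div_mult2_eq mult.commute)
  ultimately show ?thesis
    using q_less by (simp add: apply_sys_def tensor_append sum_distrib_left mult.left_commute)
qed

text \<open>The black box meets only the register of the most significant digit, so a rotation of the
  registers follows each query; after as many queries as registers all are back in place.\<close>

definition rotate_digits :: "nat \<Rightarrow> nat \<Rightarrow> nat \<Rightarrow> nat" where
  "rotate_digits D l i = (i mod D ^ l) * D + i div D ^ l"

lemma rotate_digits_div_mod:
  assumes "i < D ^ Suc l"
  shows "rotate_digits D l i div D = i mod D ^ l" "rotate_digits D l i mod D = i div D ^ l"
proof -
  have "i div D ^ l < D" using assms by (simp add: less_mult_imp_div_less)
  then show "rotate_digits D l i div D = i mod D ^ l" "rotate_digits D l i mod D = i div D ^ l"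
    by (auto simp: rotate_digits_def)
qed

lemma bij_betw_rotate_digits:
  "bij_betw (rotate_digits D l) {..<D ^ Suc l} {..<D ^ Suc l}"
proof -
  have "inj_on (rotate_digits D l) {..<D ^ Suc l}"
    by (rule inj_onI) (metis lessThan_iff rotate_digits_div_mod div_mult_mod_eq)
  moreover have "rotate_digits D l i < D ^ Suc l" if "i < D ^ Suc l" for i
    using mult_add_less_mult[of "i mod D ^ l" "D ^ l" "i div D ^ l" D] that
    by (cases "D = 0") (simp_all add: rotate_digits_def less_mult_imp_div_less mult.commute)
  ultimately show ?thesis
    by (intro bij_betw_lessThan_endoI)
qed

lemma rotate_tensor:
  "perm_mat (D ^ Suc (length hs)) (rotate_digits D (length hs)) *\<^sub>v
      vec (D ^ Suc (length hs)) (tensor D (hs @ [h])) =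
    vec (D ^ Suc (length hs)) (tensor D (h # hs))"
proof -
  have "tensor D (hs @ [h]) i = tensor D (h # hs) (rotate_digits D (length hs) i)"
    if "i < D ^ Suc (length hs)" for i
    using rotate_digits_div_mod[OF that] that
    by (simp add: tensor_append less_mult_imp_div_less)
  then have "vec (D ^ Suc (length hs)) (tensor D (hs @ [h])) =
      vec (D ^ Suc (length hs)) (\<lambda>i. tensor D (h # hs) (rotate_digits D (length hs) i))"
    by (intro eq_vecI) (auto simp del: tensor.simps power_Suc)
  then show ?thesis
    using perm_mat_mult_vec[OF bij_betw_rotate_digits] by metis
qed

lemma query_all_registers:
  assumes U: "U \<in> carrier_mat N N" and D: "D = N * M"
    and regs: "length hs + length gs = Suc l"
  shows "foldl (\<lambda>\<phi> V. V *\<^sub>v (kron U (1\<^sub>m (M * D ^ l)) *\<^sub>v \<phi>))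
      (vec (D ^ Suc l) (tensor D (hs @ gs)))
      (replicate (length gs) (perm_mat (D ^ Suc l) (rotate_digits D l))) =
    vec (D ^ Suc l) (tensor D (map (apply_sys M U) gs @ hs))"
  using regs
proof (induction gs arbitrary: hs rule: rev_induct)
  case (snoc g gs)
  have l_eq: "l = length (hs @ gs)" using snoc.prems by simp
  have dim_eq: "D ^ Suc l = N * (M * D ^ l)" by (simp add: D)
  have "kron U (1\<^sub>m (M * D ^ l)) *\<^sub>v vec (D ^ Suc l) (tensor D ((hs @ gs) @ [g])) =
      vec (D ^ Suc l) (apply_sys (M * D ^ l) U (tensor D ((hs @ gs) @ [g])))"
    using U kron_one_mult_vec[of U "M * D ^ l"] unfolding dim_eq by auto
  also have "\<dots> = vec (D ^ Suc l) (tensor D ((hs @ gs) @ [apply_sys M U g]))"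
    using U D unfolding l_eq
    by (intro eq_vecI) (simp_all only: apply_sys_tensor_snoc carrier_matD dim_vec index_vec)
  finally have "perm_mat (D ^ Suc l) (rotate_digits D l) *\<^sub>v
      (kron U (1\<^sub>m (M * D ^ l)) *\<^sub>v vec (D ^ Suc l) (tensor D (hs @ gs @ [g]))) =
      vec (D ^ Suc l) (tensor D ((apply_sys M U g # hs) @ gs))"
    using rotate_tensor[of D "hs @ gs"] by (simp only: l_eq append_assoc append_Cons)
  with snoc.IH[of "apply_sys M U g # hs"] snoc.prems show ?case
    by (simp del: power_Suc tensor.simps)
qed simp

section \<open>Block-diagonal projectors with rank-one blocks\<close>

definition block_proj :: "nat \<Rightarrow> nat \<Rightarrow> (nat \<Rightarrow> nat \<Rightarrow> complex) \<Rightarrow> complex mat" where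
  "block_proj Z Y \<chi> = mat (Z * Y) (Z * Y) (\<lambda>(i, j).
     if i mod Y = j mod Y then \<chi> (i mod Y) (i div Y) * cnj (\<chi> (j mod Y) (j div Y)) else 0)"

lemma block_proj_carrier [simp]: "block_proj Z Y \<chi> \<in> carrier_mat (Z * Y) (Z * Y)"
  by (simp add: block_proj_def)

lemma adj_block_proj: "adj (block_proj Z Y \<chi>) = block_proj Z Y \<chi>"
  by (rule eq_matI) (auto simp: adj_def block_proj_def)

lemma block_proj_idem:
  assumes unit: "\<And>y. y < Y \<Longrightarrow> cdot Z (\<chi> y) (\<chi> y) = 1"
  shows "block_proj Z Y \<chi> * block_proj Z Y \<chi> = block_proj Z Y \<chi>"
proof (rule eq_matI)
  let ?E = "block_proj Z Y \<chi>"
  fix i j assume "i < dim_row ?E" "j < dim_col ?E"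
  then have ij_less: "i < Z * Y" "j < Z * Y" by (auto simp: block_proj_def)
  then have Y_pos: "Y > 0" by (cases Y) auto
  let ?y = "i mod Y"
  have "(?E * ?E) $$ (i, j) = (\<Sum>z<Z. \<Sum>y<Y. ?E $$ (i, z * Y + y) * ?E $$ (z * Y + y, j))"
    by (simp only: sum_lessThan_mult
        index_mult_mat_sum[OF block_proj_carrier block_proj_carrier ij_less])
  also have "\<dots> = (\<Sum>z<Z. \<Sum>y<Y. if y = ?y then ?E $$ (i, j) * (cnj (\<chi> ?y z) * \<chi> ?y z) else 0)"
    using ij_less by (intro sum.cong refl) (auto simp: block_proj_def mult_add_less_mult)
  also have "\<dots> = ?E $$ (i, j) * cdot Z (\<chi> ?y) (\<chi> ?y)"
    using Y_pos by (simp add: cdot_def sum_distrib_left)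
  finally show "(?E * ?E) $$ (i, j) = ?E $$ (i, j)"
    using unit[of ?y] Y_pos by simp
qed (auto simp: block_proj_def)

lemma block_proj_mult_vec:
  "block_proj Z Y \<chi> *\<^sub>v vec (Z * Y) (\<lambda>i. \<alpha> (i mod Y) * \<beta> (i div Y)) =
    vec (Z * Y) (\<lambda>i. \<alpha> (i mod Y) * cdot Z (\<chi> (i mod Y)) \<beta> * \<chi> (i mod Y) (i div Y))"
    (is "?E *\<^sub>v ?v = ?w")
proof (rule eq_vecI)
  fix i assume "i < dim_vec ?w"
  then have i_less: "i < Z * Y" by simp
  then have Y_pos: "Y > 0" by (cases Y) auto
  let ?y = "i mod Y"
  have "(?E *\<^sub>v ?v) $ i = (\<Sum>z<Z. \<Sum>y<Y. ?E $$ (i, z * Y + y) * ?v $ (z * Y + y))"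
    by (simp only: sum_lessThan_mult
        index_mult_mat_vec_sum[OF block_proj_carrier vec_carrier i_less])
  also have "\<dots> = (\<Sum>z<Z. \<Sum>y<Y.
      if y = ?y then \<alpha> ?y * \<chi> ?y (i div Y) * (cnj (\<chi> ?y z) * \<beta> z) else 0)"
    using i_less by (intro sum.cong refl) (auto simp: block_proj_def mult_add_less_mult)
  also have "\<dots> = ?w $ i"
    using i_less Y_pos by (simp add: cdot_def sum_distrib_left sum_distrib_right mult_ac)
  finally show "(?E *\<^sub>v ?v) $ i = ?w $ i" .
qed (simp add: block_proj_def)

lemma block_proj_expectation:
  fixes Z Y :: nat and \<chi> :: "nat \<Rightarrow> nat \<Rightarrow> complex" and \<alpha> \<beta> :: "nat \<Rightarrow> complex"
  defines "v \<equiv> vec (Z * Y) (\<lambda>i. \<alpha> (i mod Y) * \<beta> (i div Y))"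
  shows "(block_proj Z Y \<chi> *\<^sub>v v) \<bullet>c v =
    (\<Sum>y<Y. (cmod (\<alpha> y))\<^sup>2 * (cmod (cdot Z (\<chi> y) \<beta>))\<^sup>2)"
proof -
  let ?s = "\<lambda>y. cdot Z (\<chi> y) \<beta>"
  have "(block_proj Z Y \<chi> *\<^sub>v v) \<bullet>c v =
      (\<Sum>z<Z. \<Sum>y<Y. (\<alpha> y * cnj (\<alpha> y)) * (?s y * cnj (cnj (\<chi> y z) * \<beta> z)))"
    unfolding v_def block_proj_mult_vec vec_cscalar_prod_vec cdot_def[of "Z * Y"] sum_lessThan_mult
    by (intro sum.cong refl) (simp add: mult_ac)
  also have "\<dots> = (\<Sum>y<Y. (\<alpha> y * cnj (\<alpha> y)) * (?s y * cnj (?s y)))"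
    by (subst sum.swap) (simp add: cdot_def sum_distrib_left)
  finally show ?thesis
    by (simp only: of_real_sum of_real_mult complex_norm_square)
qed

section \<open>Testing a set of unitaries that is separated by basis states\<close>

text \<open>A register of dimension \<open>N * N\<close> pairs the system (high digit) with a reference (low digit).\<close>

definition basis_reg :: "nat \<Rightarrow> nat \<Rightarrow> nat \<Rightarrow> complex" where
  "basis_reg N x w = of_bool (w = x * N)"

definition choi_reg :: "nat \<Rightarrow> nat \<Rightarrow> complex" where
  "choi_reg N w = of_bool (w div N = w mod N) / sqrt N"

lemma apply_sys_basis_reg:
  assumes "dim_col U = N" "x < N"
  shows "apply_sys N U (basis_reg N x) w = (if w mod N = 0 then U $$ (w div N, x) else 0)"
proof -
  have "a * N + w mod N = x * N \<longleftrightarrow> a = x \<and> w mod N = 0" for a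
  proof
    assume index_eq: "a * N + w mod N = x * N"
    then have "w mod N = 0"
      using assms(2) by (metis mod_mult_self2_is_0 mod_mult_self3 mod_mod_trivial)
    then show "a = x \<and> w mod N = 0" using index_eq assms(2) by simp
  qed simp
  then have "apply_sys N U (basis_reg N x) w =
      (\<Sum>a<N. if a = x then if w mod N = 0 then U $$ (w div N, x) else 0 else 0)"
    unfolding apply_sys_def basis_reg_def using assms by (intro sum.cong) auto
  then show ?thesis using assms by simp
qed

lemma apply_sys_choi_reg:
  assumes "dim_col U = N" "N > 0"
  shows "apply_sys N U (choi_reg N) w = U $$ (w div N, w mod N) / sqrt N"
proof -
  have "apply_sys N U (choi_reg N) w =
      (\<Sum>a<N. if a = w mod N then U $$ (w div N, w mod N) / sqrt N else 0)"
    unfolding apply_sys_def choi_reg_def using assms by (intro sum.cong) auto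
  then show ?thesis using assms by simp
qed

lemma cdot_basis_reg_self:
  assumes "x < N"
  shows "cdot (N * N) (basis_reg N x) (basis_reg N x) = 1"
  unfolding basis_reg_def cdot_of_bool_eq using assms by simp

lemma cdot_apply_sys_choi_reg:
  assumes "U \<in> carrier_mat N N" "V \<in> carrier_mat N N"
  shows "cdot (N * N) (apply_sys N V (choi_reg N)) (apply_sys N U (choi_reg N)) =
    hs_inner V U / N"
proof -
  have "complex_of_real (sqrt N) * complex_of_real (sqrt N) = of_nat N"
    by (metis of_real_mult of_real_of_nat_eq real_sqrt_mult_self abs_of_nat)
  then show ?thesis
    unfolding cdot_def sum_lessThan_mult hs_inner_sum[OF assms(2,1)] sum_divide_distrib
    using assms by (intro sum.cong refl) (auto simp: apply_sys_choi_reg)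
qed

lemma cdot_choi_reg_self:
  assumes "N > 0"
  shows "cdot (N * N) (choi_reg N) (choi_reg N) = 1"
proof -
  have "cdot (N * N) (choi_reg N) (choi_reg N) = (\<Sum>a<N. \<Sum>b<N. if b = a then 1 / of_nat N else 0)"
    unfolding cdot_def sum_lessThan_mult
    by (intro sum.cong refl)
      (auto simp: choi_reg_def of_real_mult[symmetric] simp del: of_real_mult)
  also have "\<dots> = 1" using assms by simp
  finally show ?thesis .
qed

lemma power_one_minus_le_inverse:
  fixes x :: real
  assumes "0 \<le> x" "x \<le> 1"
  shows "(1 - x) ^ m \<le> 1 / (1 + real m * x)"
proof -
  have "(1 - x) ^ m * (1 + real m * x) \<le> (1 - x) ^ m * (1 + x) ^ m"
    using assms by (intro mult_left_mono Bernoulli_inequality) auto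
  also have "\<dots> = (1 - x\<^sup>2) ^ m"
    by (simp add: power_mult_distrib[symmetric] algebra_simps power2_eq_square)
  also have "\<dots> \<le> 1" using assms by (intro power_le_one) (auto simp: power_le_one)
  finally show ?thesis
    using assms by (subst pos_le_divide_eq) (auto intro: add_pos_nonneg)
qed

lemma eps_tests_without_queries:
  assumes "N > 0" "\<epsilon> > 1" "S \<subseteq> unitaries N" "S \<noteq> {}"
  shows "\<exists>A. eps_tests N \<epsilon> S A \<and> num_queries A = 0"
proof -
  let ?A = "\<lparr>anc_dim = 1, init_state = unit_vec N 0, ops = [], accept_proj = 1\<^sub>m N\<rparr>"
  have "unit_vec N 0 = vec N (\<lambda>i. of_bool (i = 0) :: complex)"
    by (auto simp: unit_vec_def)
  then have unit: "unit_vec N 0 \<bullet>c unit_vec N 0 = (1 :: complex)"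
    using assms(1) by (simp only: vec_cscalar_prod_vec cdot_of_bool_eq) simp
  have "adj (1\<^sub>m N) = 1\<^sub>m N"
    by (rule eq_matI) (auto simp: adj_def)
  then have "valid_alg N ?A" by (simp add: valid_alg_def unit)
  moreover have "accept_prob ?A U = 1" for U
    by (simp add: accept_prob_def final_state_def unit)
  moreover have "\<not> eps_far N \<epsilon> S U" if "U \<in> unitaries N" for U
    using eps_far_imp_le_one[of N \<epsilon> S U] assms that by auto
  ultimately have "eps_tests N \<epsilon> S ?A" by (simp add: eps_tests_def)
  then show ?thesis by (intro exI[of _ ?A]) (simp add: num_queries_def)
qed

locale basis_separated_unitaries =
  fixes N :: nat and S :: "complex mat set" and xs :: "nat list"
  assumes dim_pos: "N > 0"
    and unitary: "S \<subseteq> unitaries N"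
    and nonempty: "S \<noteq> {}"
    and probes: "set xs \<subseteq> {..<N}"
    and separated: "\<lbrakk>V \<in> S; W \<in> S;
      \<And>x. x \<in> set xs \<Longrightarrow> \<exists>i<N. V $$ (i, x) \<noteq> 0 \<and> W $$ (i, x) \<noteq> 0\<rbrakk> \<Longrightarrow> V = W"
begin

abbreviation reg_dim :: nat where
  "reg_dim \<equiv> N * N"

abbreviation probe_amplitude :: "complex mat \<Rightarrow> nat \<Rightarrow> complex" where
  "probe_amplitude U \<equiv> tensor reg_dim (map (apply_sys N U \<circ> basis_reg N) xs)"

abbreviation choi_amplitude :: "nat \<Rightarrow> complex mat \<Rightarrow> nat \<Rightarrow> complex" where
  "choi_amplitude k U \<equiv> tensor reg_dim (replicate k (apply_sys N U (choi_reg N)))"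

definition outcome_row :: "nat \<Rightarrow> nat \<Rightarrow> nat" where
  "outcome_row y j = y div reg_dim ^ j mod reg_dim div N"

definition consistent :: "nat \<Rightarrow> complex mat \<Rightarrow> bool" where
  "consistent y V \<longleftrightarrow> (\<forall>j<length xs. V $$ (outcome_row y j, xs ! j) \<noteq> 0)"

definition guess :: "nat \<Rightarrow> complex mat" where
  "guess y = (SOME V. V \<in> S \<and> ((\<exists>W\<in>S. consistent y W) \<longrightarrow> consistent y V))"

lemma outcome_row_less: "outcome_row y j < N"
  using dim_pos by (simp add: outcome_row_def less_mult_imp_div_less)

lemma consistent_unique:
  assumes "V \<in> S" "W \<in> S" "consistent y V" "consistent y W"
  shows "V = W"
  using assms(1,2)
proof (rule separated)
  fix x assume "x \<in> set xs"
  then obtain j where "j < length xs" "x = xs ! j" by (auto simp: in_set_conv_nth)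
  then show "\<exists>i<N. V $$ (i, x) \<noteq> 0 \<and> W $$ (i, x) \<noteq> 0"
    using assms(3,4) outcome_row_less[of y j] by (auto simp: consistent_def)
qed

lemma guess_in: "guess y \<in> S"
  and consistent_guess: "V \<in> S \<Longrightarrow> consistent y V \<Longrightarrow> consistent y (guess y)"
proof -
  have "\<exists>V. V \<in> S \<and> ((\<exists>W\<in>S. consistent y W) \<longrightarrow> consistent y V)"
    using nonempty by blast
  from someI_ex[OF this]
  show "guess y \<in> S" "V \<in> S \<Longrightarrow> consistent y V \<Longrightarrow> consistent y (guess y)"
    unfolding guess_def by blast+
qed

lemma guess_unitary: "guess y \<in> unitaries N"
  using guess_in unitary by blast

lemma probe_amplitude_neq_0_imp_consistent:
  assumes "dim_col U = N" "probe_amplitude U y \<noteq> 0"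
  shows "consistent y U"
  unfolding consistent_def
proof (intro allI impI)
  fix j assume j_less: "j < length xs"
  then have "xs ! j < N" using probes nth_mem by blast
  then show "U $$ (outcome_row y j, xs ! j) \<noteq> 0"
    using tensor_neq_0_imp_nth_neq_0[OF assms(2), of j] j_less assms(1)
    by (auto simp: outcome_row_def apply_sys_basis_reg split: if_splits)
qed

lemma guess_eq_if_probe_amplitude_neq_0:
  assumes V: "V \<in> S" and amplitude: "probe_amplitude (c \<cdot>\<^sub>m V) y \<noteq> 0"
  shows "guess y = V"
proof -
  have V_carrier: "V \<in> carrier_mat N N" using V unitary unitaries_carrier by blast
  then have "consistent y (c \<cdot>\<^sub>m V)"
    using probe_amplitude_neq_0_imp_consistent[OF _ amplitude] by simp
  then have "consistent y V"
    using V_carrier probes by (auto simp: consistent_def outcome_row_less subset_iff)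
  then show ?thesis
    using V guess_in consistent_guess consistent_unique by blast
qed

lemma sum_probe_amplitude:
  assumes "U \<in> unitaries N"
  shows "(\<Sum>y<reg_dim ^ length xs. (cmod (probe_amplitude U y))\<^sup>2) = 1"
proof -
  have "cdot (reg_dim ^ length xs) (probe_amplitude U) (probe_amplitude U) = 1"
  proof -
    have "cdot reg_dim h h = 1" if "h \<in> set (map (apply_sys N U \<circ> basis_reg N) xs)" for h
      using that probes by (auto simp: cdot_apply_sys[OF assms] cdot_basis_reg_self)
    then show ?thesis
      using cdot_tensor_unit[of "map (apply_sys N U \<circ> basis_reg N) xs" reg_dim]
      by (simp only: length_map)
  qed
  then show ?thesis unfolding cdot_self by (simp only: of_real_eq_1_iff)
qed

definition init_regs :: "nat \<Rightarrow> (nat \<Rightarrow> complex) list" where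
  "init_regs k = map (basis_reg N) xs @ replicate k (choi_reg N)"

definition tester :: "nat \<Rightarrow> alg" where
  "tester k = (let l = length xs + k - 1 in
    \<lparr>anc_dim = N * reg_dim ^ l,
     init_state = vec (reg_dim ^ Suc l) (tensor reg_dim (init_regs k)),
     ops = replicate (length xs + k) (perm_mat (reg_dim ^ Suc l) (rotate_digits reg_dim l)),
     accept_proj = block_proj (reg_dim ^ k) (reg_dim ^ length xs)
       (\<lambda>y. choi_amplitude k (guess y))\<rparr>)"

lemma num_queries_tester: "num_queries (tester k) = length xs + k"
  by (simp add: num_queries_def tester_def Let_def)

lemma length_init_regs [simp]: "length (init_regs k) = length xs + k"
  by (simp add: init_regs_def)

lemma cdot_choi_amplitude_guess:
  assumes "U \<in> carrier_mat N N"
  shows "cdot (reg_dim ^ k) (choi_amplitude k (guess y)) (choi_amplitude k U) =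
    (hs_inner (guess y) U / N) ^ k"
  unfolding cdot_tensor_replicate
  using assms guess_unitary unitaries_carrier dim_pos by (simp add: cdot_apply_sys_choi_reg)

lemma tester_valid:
  assumes k: "k > 0"
  shows "valid_alg N (tester k)"
proof -
  define l where "l = length xs + k - 1"
  have regs: "length xs + k = Suc l" using k by (simp add: l_def)
  have dim_eq: "N * (N * reg_dim ^ l) = reg_dim ^ Suc l"
    "reg_dim ^ k * reg_dim ^ length xs = reg_dim ^ Suc l"
    by (simp, simp only: regs[symmetric] power_add mult.commute)
  have "cdot (reg_dim ^ Suc l) (tensor reg_dim (init_regs k)) (tensor reg_dim (init_regs k)) = 1"
  proof -
    have "cdot reg_dim h h = 1" if "h \<in> set (init_regs k)" for h
      using that probes dim_pos
      by (auto simp: init_regs_def cdot_basis_reg_self cdot_choi_reg_self)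
    then show ?thesis
      using cdot_tensor_unit[of "init_regs k" reg_dim] by (simp only: length_init_regs regs)
  qed
  moreover have
    "perm_mat (reg_dim ^ Suc l) (rotate_digits reg_dim l) \<in> unitaries (reg_dim ^ Suc l)"
    by (intro perm_mat_unitary bij_betw_rotate_digits)
  moreover have
    "cdot (reg_dim ^ k) (choi_amplitude k (guess y)) (choi_amplitude k (guess y)) = 1" for y
    using dim_pos
    by (simp add: cdot_choi_amplitude_guess unitaries_carrier guess_unitary
        hs_inner_self_unitary[OF guess_unitary])
  ultimately show ?thesis
    using dim_pos block_proj_carrier[of "reg_dim ^ k" "reg_dim ^ length xs"]
    unfolding valid_alg_def tester_def Let_def l_def[symmetric]
    by (auto simp: dim_eq vec_cscalar_prod_vec adj_block_proj block_proj_idem simp del: power_Suc)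
qed

lemma final_state_tester:
  assumes k: "k > 0" and U: "U \<in> carrier_mat N N"
  shows "final_state (tester k) U = vec (reg_dim ^ k * reg_dim ^ length xs)
    (\<lambda>i. probe_amplitude U (i mod reg_dim ^ length xs) *
      choi_amplitude k U (i div reg_dim ^ length xs))"
proof -
  define l where "l = length xs + k - 1"
  have regs: "length xs + k = Suc l" using k by (simp add: l_def)
  have "final_state (tester k) U =
      vec (reg_dim ^ Suc l) (tensor reg_dim (map (apply_sys N U) (init_regs k)))"
    using query_all_registers[OF U, of reg_dim N "[]" "init_regs k" l]
    by (simp add: final_state_def tester_def Let_def regs del: power_Suc flip: l_def)
  also have "reg_dim ^ Suc l = reg_dim ^ k * reg_dim ^ length xs"
    unfolding regs[symmetric] by (simp add: power_add mult.commute)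
  finally show ?thesis
    by (simp add: init_regs_def tensor_append)
qed

lemma accept_prob_tester:
  assumes k: "k > 0" and U: "U \<in> unitaries N"
  shows "accept_prob (tester k) U = (\<Sum>y<reg_dim ^ length xs.
    (cmod (probe_amplitude U y))\<^sup>2 * (cmod (hs_inner (guess y) U) / N) ^ (2 * k))"
proof -
  note U_carrier = unitaries_carrier[OF U]
  have "accept_prob (tester k) U = (\<Sum>y<reg_dim ^ length xs.
      (cmod (probe_amplitude U y))\<^sup>2 * (cmod ((hs_inner (guess y) U / N) ^ k))\<^sup>2)"
    unfolding accept_prob_def Let_def final_state_tester[OF k U_carrier]
    by (simp add: tester_def Let_def block_proj_expectation
        cdot_choi_amplitude_guess[OF U_carrier])
  then show ?thesis
    by (simp add: norm_power norm_divide power_mult[symmetric] mult.commute)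
qed

lemma accept_prob_tester_has_property:
  assumes k: "k > 0" and U: "U \<in> unitaries N" "has_property S U"
  shows "accept_prob (tester k) U = 1"
proof -
  obtain V \<theta> where V: "V \<in> S" and U_eq: "U = exp (\<i> * complex_of_real \<theta>) \<cdot>\<^sub>m V"
    using U(2) by (auto simp: has_property_def)
  have "V \<in> unitaries N" using V unitary by blast
  then have "hs_inner V U = exp (\<i> * complex_of_real \<theta>) * N"
    unfolding U_eq
    by (simp add: hs_inner_smult_right[of _ N N] unitaries_carrier hs_inner_self_unitary)
  then have overlap: "cmod (hs_inner V U) / N = 1"
    using dim_pos by (simp add: norm_mult)
  have "(cmod (probe_amplitude U y))\<^sup>2 * (cmod (hs_inner (guess y) U) / N) ^ (2 * k) =
      (cmod (probe_amplitude U y))\<^sup>2" for y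
  proof (cases "probe_amplitude U y = 0")
    case False
    then have "guess y = V"
      unfolding U_eq by (rule guess_eq_if_probe_amplitude_neq_0[OF V])
    then show ?thesis by (simp add: overlap)
  qed simp
  then show ?thesis
    by (simp only: accept_prob_tester[OF k U(1)] sum_probe_amplitude[OF U(1)])
qed

lemma accept_prob_tester_eps_far:
  assumes k: "1 \<le> real k * \<epsilon>\<^sup>2" and \<epsilon>: "\<epsilon> > 0" and U: "U \<in> unitaries N" "eps_far N \<epsilon> S U"
  shows "accept_prob (tester k) U \<le> 1 / 3"
proof -
  have "k > 0" using k by (cases k) auto
  have "\<epsilon> \<le> 1"
    using eps_far_imp_le_one[OF dim_pos \<epsilon> unitary nonempty U] .
  have "accept_prob (tester k) U \<le>
      (\<Sum>y<reg_dim ^ length xs. (cmod (probe_amplitude U y))\<^sup>2 * (1 / 3))"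
    unfolding accept_prob_tester[OF \<open>k > 0\<close> U(1)]
  proof (intro sum_mono mult_left_mono)
    fix y
    have "(cmod (hs_inner (guess y) U) / N) ^ (2 * k) \<le> (1 - \<epsilon>\<^sup>2) ^ (2 * k)"
      using eps_far_hs_inner_le[OF dim_pos \<epsilon> unitary U guess_in] by (intro power_mono) auto
    also have "\<dots> \<le> 1 / (1 + real (2 * k) * \<epsilon>\<^sup>2)"
      using \<epsilon> \<open>\<epsilon> \<le> 1\<close> by (intro power_one_minus_le_inverse) (auto simp: power_le_one)
    also have "\<dots> \<le> 1 / 3"
      using k by (intro divide_left_mono) auto
    finally show "(cmod (hs_inner (guess y) U) / N) ^ (2 * k) \<le> 1 / 3" .
  qed auto
  then show ?thesis
    by (simp only: sum_distrib_right[symmetric] sum_probe_amplitude[OF U(1)] mult_1_left)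
qed

lemma eps_tests_tester:
  assumes "\<epsilon> > 0" "1 \<le> real k * \<epsilon>\<^sup>2"
  shows "eps_tests N \<epsilon> S (tester k)"
proof -
  have "k > 0" using assms by (cases k) auto
  then show ?thesis
    using assms tester_valid accept_prob_tester_has_property accept_prob_tester_eps_far
    by (simp add: eps_tests_def)
qed

lemma eps_testable:
  assumes "\<epsilon> > 0"
  shows "\<exists>A. eps_tests N \<epsilon> S A \<and> num_queries A = length xs + nat \<lceil>1 / \<epsilon>\<^sup>2\<rceil>"
proof -
  have "1 / \<epsilon>\<^sup>2 \<le> real (nat \<lceil>1 / \<epsilon>\<^sup>2\<rceil>)" by simp
  then have "1 \<le> real (nat \<lceil>1 / \<epsilon>\<^sup>2\<rceil>) * \<epsilon>\<^sup>2"
    using assms by (simp only: pos_divide_le_eq zero_less_power)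
  from eps_tests_tester[OF assms this] num_queries_tester show ?thesis by blast
qed

end

section \<open>Qubit permutations\<close>

lemma qbit_bit: "qbit n x k = of_bool (bit x (n - k))"
  by (simp add: qbit_def bit_iff_odd mod_2_eq_odd)

lemma qbit_eqI:
  assumes "x < 2 ^ n" "y < 2 ^ n" and qbits: "\<And>k. k \<in> {1..n} \<Longrightarrow> qbit n x k = qbit n y k"
  shows "x = y"
proof -
  have "bit x i = bit y i" if "i < n" for i
    using qbits[of "n - i"] that by (simp add: qbit_bit of_bool_eq_iff)
  then have "take_bit n x = take_bit n y"
    by (intro bit_eqI) (auto simp: bit_take_bit_iff)
  then show ?thesis using assms by (simp add: take_bit_nat_eq_self)
qed

definition permute_qbits :: "nat \<Rightarrow> (nat \<Rightarrow> nat) \<Rightarrow> nat \<Rightarrow> nat" where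
  "permute_qbits n \<tau> x = horner_sum of_bool 2 (map (\<lambda>i. bit x (n - \<tau> (n - i))) [0..<n])"

lemma permute_qbits_less: "permute_qbits n \<tau> x < 2 ^ n"
  unfolding permute_qbits_def
  using horner_sum_of_bool_2_less[of "map (\<lambda>i. bit x (n - \<tau> (n - i))) [0..<n]"] by simp

lemma qbit_permute_qbits: "k \<in> {1..n} \<Longrightarrow> qbit n (permute_qbits n \<tau> x) k = qbit n x (\<tau> k)"
  by (auto simp: qbit_bit permute_qbits_def bit_horner_sum_bit_iff)

lemma bij_betw_permute_qbits:
  assumes "\<tau> permutes {1..n}"
  shows "bij_betw (permute_qbits n \<tau>) {..<2 ^ n} {..<2 ^ n}"
proof -
  have "x = y" if less: "x < 2 ^ n" "y < 2 ^ n"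
    and eq: "permute_qbits n \<tau> x = permute_qbits n \<tau> y" for x y
  proof (rule qbit_eqI[OF less])
    fix j assume "j \<in> {1..n}"
    then obtain k where "k \<in> {1..n}" "j = \<tau> k" using permutes_image[OF assms] by blast
    then show "qbit n x j = qbit n y j" using eq qbit_permute_qbits by metis
  qed
  then have "inj_on (permute_qbits n \<tau>) {..<2 ^ n}" by (auto simp: inj_on_def)
  then show ?thesis by (intro bij_betw_lessThan_endoI permute_qbits_less)
qed

lemma perm_op_eq_perm_mat: "perm_op n \<tau> = perm_mat (2 ^ n) (permute_qbits n \<tau>)"
proof -
  have "(\<forall>k\<in>{1..n}. qbit n r k = qbit n c (\<tau> k)) \<longleftrightarrow> r = permute_qbits n \<tau> c" if "r < 2 ^ n" for r c
    using qbit_eqI[OF that permute_qbits_less] qbit_permute_qbits by metis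
  then show ?thesis
    by (intro eq_matI) (auto simp: perm_op_def perm_mat_def)
qed

text \<open>Qubit 1 is the most significant bit, so \<open>2 ^ (n - j)\<close> is the basis index with only qubit
  \<open>j\<close> set.\<close>

lemma qbit_single: "k \<in> {1..n} \<Longrightarrow> j \<in> {1..n} \<Longrightarrow> qbit n (2 ^ (n - j)) k = of_bool (k = j)"
  by (auto simp: qbit_bit bit_exp_iff)

lemma permutation_eq_if_permute_qbits_single_eq:
  assumes \<sigma>: "\<sigma> permutes {1..n}" and \<tau>: "\<tau> permutes {1..n}"
    and single: "\<And>j. j \<in> {1..n} \<Longrightarrow>
      permute_qbits n \<sigma> (2 ^ (n - j)) = permute_qbits n \<tau> (2 ^ (n - j))"
  shows "\<sigma> = \<tau>"
proof
  fix k
  show "\<sigma> k = \<tau> k"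
  proof (cases "k \<in> {1..n}")
    case True
    then have k: "\<sigma> k \<in> {1..n}" "\<tau> k \<in> {1..n}"
      using permutes_in_image \<sigma> \<tau> by metis+
    then have "qbit n (2 ^ (n - \<sigma> k)) (\<sigma> k) = qbit n (2 ^ (n - \<sigma> k)) (\<tau> k)"
      using single[of "\<sigma> k"] qbit_permute_qbits True by metis
    then show ?thesis
      using k by (simp only: qbit_single of_bool_eq_iff) simp
  qed (simp add: permutes_not_in[OF \<sigma>] permutes_not_in[OF \<tau>])
qed

lemma basis_separated_qubit_perms:
  "basis_separated_unitaries (2 ^ n) (qubit_perms n) (map (\<lambda>j. 2 ^ (n - j)) [1..<Suc n])"
proof
  show "qubit_perms n \<subseteq> unitaries (2 ^ n)"
    unfolding qubit_perms_def perm_op_eq_perm_mat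
    using perm_mat_unitary bij_betw_permute_qbits by blast
  show "qubit_perms n \<noteq> {}"
    unfolding qubit_perms_def using permutes_id by blast
  show "set (map (\<lambda>j. (2::nat) ^ (n - j)) [1..<Suc n]) \<subseteq> {..<2 ^ n}"
    by (auto simp del: upt_Suc)
next
  fix V W
  assume "V \<in> qubit_perms n" "W \<in> qubit_perms n"
  then obtain \<sigma> \<tau> where \<sigma>: "\<sigma> permutes {1..n}" "V = perm_op n \<sigma>"
    and \<tau>: "\<tau> permutes {1..n}" "W = perm_op n \<tau>"
    by (auto simp: qubit_perms_def)
  assume overlap: "\<And>x. x \<in> set (map (\<lambda>j. 2 ^ (n - j)) [1..<Suc n]) \<Longrightarrow>
    \<exists>i<2 ^ n. V $$ (i, x) \<noteq> 0 \<and> W $$ (i, x) \<noteq> 0"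
  have "permute_qbits n \<sigma> (2 ^ (n - j)) = permute_qbits n \<tau> (2 ^ (n - j))"
    if j: "j \<in> {1..n}" for j
  proof -
    have "\<exists>i<2 ^ n. V $$ (i, 2 ^ (n - j)) \<noteq> 0 \<and> W $$ (i, 2 ^ (n - j)) \<noteq> 0"
      using j by (intro overlap) auto
    moreover have "(2::nat) ^ (n - j) < 2 ^ n" using j by auto
    ultimately show ?thesis
      by (auto simp: \<sigma>(2) \<tau>(2) perm_op_eq_perm_mat perm_mat_def)
  qed
  then show "V = W"
    using permutation_eq_if_permute_qbits_single_eq[OF \<sigma>(1) \<tau>(1)] \<sigma>(2) \<tau>(2) by blast
qed simp

lemma add_nat_ceiling_le_mult_ln:
  fixes \<epsilon> :: real
  assumes "n \<ge> 2" "0 < \<epsilon>" "\<epsilon> \<le> 1"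
  shows "real (n + nat \<lceil>1 / \<epsilon>\<^sup>2\<rceil>) \<le> 2 / ln 2 * real n * ln (real n) / \<epsilon>\<^sup>2"
proof -
  have "\<epsilon>\<^sup>2 \<le> 1" using assms by (simp add: power_le_one)
  have "real (n + nat \<lceil>1 / \<epsilon>\<^sup>2\<rceil>) \<le> real n + 1 + 1 / \<epsilon>\<^sup>2"
    using of_int_ceiling_le_add_one[of "1 / \<epsilon>\<^sup>2"] by (simp add: add.commute)
  also have "\<dots> \<le> (real n + 1) / \<epsilon>\<^sup>2 + 1 / \<epsilon>\<^sup>2"
    using assms(2) mult_left_le[OF \<open>\<epsilon>\<^sup>2 \<le> 1\<close>, of "real n + 1"] by (simp add: pos_le_divide_eq)
  also have "\<dots> \<le> 2 * real n / \<epsilon>\<^sup>2"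
    unfolding add_divide_distrib[symmetric] using assms(1) by (intro divide_right_mono) auto
  also have "\<dots> \<le> 2 / ln 2 * real n * ln (real n) / \<epsilon>\<^sup>2"
  proof (intro divide_right_mono)
    have "ln 2 \<le> ln (real n)" using assms(1) by simp
    then show "2 * real n \<le> 2 / ln 2 * real n * ln (real n)"
      using assms(1) by (simp add: field_simps)
  qed simp
  finally show ?thesis .
qed

theorem theorem5:
  shows "\<exists>C>0. \<forall>n\<ge>2. \<forall>\<epsilon>>0. \<exists>A.
     eps_tests (2^n) \<epsilon> (qubit_perms n) A \<and>
     real (num_queries A) \<le> C * real n * ln (real n) / \<epsilon>^2"
proof (intro exI[of _ "2 / ln 2"] conjI allI impI)
  fix n :: nat and \<epsilon> :: real
  assume n: "n \<ge> 2" and \<epsilon>: "\<epsilon> > 0"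
  interpret basis_separated_unitaries "2 ^ n" "qubit_perms n" "map (\<lambda>j. 2 ^ (n - j)) [1..<Suc n]"
    by (rule basis_separated_qubit_perms)
  show "\<exists>A. eps_tests (2 ^ n) \<epsilon> (qubit_perms n) A \<and>
      real (num_queries A) \<le> 2 / ln 2 * real n * ln (real n) / \<epsilon>^2"
  proof (cases "\<epsilon> \<le> 1")
    case True
    then show ?thesis
      using eps_testable[OF \<epsilon>] add_nat_ceiling_le_mult_ln[OF n \<epsilon>] by auto
  next
    case False
    then obtain A where "eps_tests (2 ^ n) \<epsilon> (qubit_perms n) A" "num_queries A = 0"
      using eps_tests_without_queries[OF dim_pos _ unitary nonempty] by force
    then show ?thesis using n by (intro exI[of _ A]) simp
  qed
qed simp

end
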